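(* Let $r\in\mathbb{Z}_{>1}$ and let $t_1,\ldots,t_5,q\in\mathbb{C}$ be such that $|t_a|,|q|<1$. Put $A=\prod_{a=1}^5t_a$. Then $$\frac{(q^r;q^r)_\infty}{2\pi\mathrm{i}}\int_{\mathbb{T}}\frac{(q^{r-1}Az,\,Az^{-1},\,q^{r-1}z^2,\,qz^{-2};q^r)_\infty}{\prod_{a=1}^3(q^{r-1}t_az,\,t_az^{-1};q^r)_\infty\,\prod_{a=4}^5(t_az,\,qt_az^{-1};q^r)_\infty}\frac{dz}{z}$$ $$=\frac{\prod_{a=1}^3(At_a^{-1};q^r)_\infty\,\prod_{a=4}^5(q^{r-1}At_a^{-1};q^r)_\infty}{\prod_{1\le a<b\le3}(q^{r-1}t_at_b;q^r)_\infty\,\prod_{a=1}^3\prod_{b=4}^5(t_at_b;q^r)_\infty\,(qt_4t_5;q^r)_\infty},$$ where $\mathbb{T}$ is the positively oriented unit circle.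
   Context: Notation: $(z;p)_\infty=\prod_{j\ge0}(1-zp^j)$ for $|p|<1$ and $(z_1,\ldots,z_k;p)_\infty=\prod_{i=1}^k(z_i;p)_\infty$. The expression $At_a^{-1}$ stands for the product $\prod_{b\neq a}t_b$ of the remaining parameters. *)

theory Defs
  imports "HOL-Complex_Analysis.Contour_Integration"
begin

definition qpoch_inf :: "complex \<Rightarrow> complex \<Rightarrow> complex" where
  "qpoch_inf z p = (\<Prod>j. 1 - z * p ^ j)"

text \<open>The product converges for all \<open>z\<close> as soon as \<open>norm p < 1\<close>; for \<open>p = 0\<close> it is \<open>1 - z\<close>,
  because \<open>0 ^ 0 = 1\<close>.\<close>

lemma qpoch_inf_has_prod:
  assumes "norm p < 1"
  shows "(\<lambda>j. 1 - z * p ^ j) has_prod qpoch_inf z p"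
proof -
  have "summable (\<lambda>j. norm (z * p ^ j))"
    using assms by (simp add: norm_mult norm_power summable_mult summable_geometric)
  then have "abs_convergent_prod (\<lambda>j. 1 - z * p ^ j)"
    by (simp add: abs_convergent_prod_conv_summable)
  then have "convergent_prod (\<lambda>j. 1 - z * p ^ j)"
    by (rule abs_convergent_prod_imp_convergent_prod)
  then show ?thesis
    unfolding qpoch_inf_def by (rule convergent_prod_has_prod)
qed

text \<open>\<open>qpoch_infs [z1, \<dots>, zk] p\<close> is the condensed notation with several upper arguments.\<close>

definition qpoch_infs :: "complex list \<Rightarrow> complex \<Rightarrow> complex" where
  "qpoch_infs zs p = (\<Prod>z\<leftarrow>zs. qpoch_inf z p)"

text \<open>The product of the parameters other than \<open>t a\<close>, which is meaningful also when \<open>t a = 0\<close>.\<close>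

definition prod_except :: "(nat \<Rightarrow> complex) \<Rightarrow> nat \<Rightarrow> complex" where
  "prod_except t a = (\<Prod>b\<in>{1..5} - {a}. t b)"

end

theory Submission
  imports Defs "HOL-Complex_Analysis.Complex_Analysis"
begin

text \<open>Put \<open>u = q\<close>, \<open>v = q ^ (r - 1)\<close>, \<open>p = u * v\<close>; the identity holds for arbitrary \<open>u\<close>, \<open>v\<close> in the
  unit disc. Under \<open>z = w / \<surd>v\<close> the kernel is that of the Nassrallah--Rahman integral, times a factor
  whose symmetrization in \<open>w \<mapsto> 1 / w\<close> is constant, but for large \<open>t 4\<close>, \<open>t 5\<close> the contour no longer
  separates the poles of the symmetric kernel, so the argument stays with the asymmetric one.

  Let \<open>Q\<close> be the quotient of the integral by the product on the right. The kernels at \<open>t 1\<close> and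
  \<open>p * t 1\<close>, weighted so that the products on the right agree, differ by a combination of
  \<open>\<kappa>(z)\<close> and \<open>\<psi>(z) - \<psi>(1 / (v * z))\<close>, where \<open>\<kappa>(u / z) = - \<kappa>(z)\<close>, and \<open>\<kappa>\<close>, \<open>\<psi>\<close> have no poles
  in the annuli between the unit circle and its images under these inversions (for \<open>u = 0\<close> or
  \<open>v = 0\<close> the corresponding mean vanishes by Cauchy's formula). Hence \<open>Q\<close> is invariant
  under \<open>t 1 \<mapsto> p * t 1\<close>, and by continuity at \<open>0\<close> it does not depend on \<open>t 1\<close>, \<open>t 2\<close>, \<open>t 3\<close>. When
  \<open>t 3 = 0\<close>, the inversion \<open>z \<mapsto> 1 / z\<close> exchanges \<open>(t 1, t 2, u)\<close> with \<open>(t 4, t 5, v)\<close>, so \<open>Q\<close> is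
  constant. At \<open>(\<surd>u, - \<surd>u, 0, \<surd>v, - \<surd>v)\<close> the kernel is \<open>1\<close>.\<close>

section \<open>Infinite shifted factorials\<close>

lemma qpoch_inf_tendsto:
  assumes "norm p < 1"
  shows "(\<lambda>n. \<Prod>k<n. 1 - z * p ^ k) \<longlonglongrightarrow> qpoch_inf z p"
  by (rule has_prod_imp_tendsto'[OF qpoch_inf_has_prod[OF assms]])

lemma qpoch_inf_0 [simp]: "qpoch_inf 0 p = 1"
  by (simp add: qpoch_inf_def)

lemma qpoch_inf_unfold:
  assumes "norm p < 1"
  shows "qpoch_inf z p = (1 - z) * qpoch_inf (p * z) p"
proof -
  have "(\<lambda>n. \<Prod>k<Suc n. 1 - z * p ^ k) \<longlonglongrightarrow> qpoch_inf z p"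
    using qpoch_inf_tendsto[OF assms] by (rule LIMSEQ_Suc)
  moreover have "(\<lambda>n. (1 - z) * (\<Prod>k<n. 1 - (p * z) * p ^ k)) \<longlonglongrightarrow> (1 - z) * qpoch_inf (p * z) p"
    by (intro tendsto_intros qpoch_inf_tendsto assms)
  moreover have "(\<Prod>k<Suc n. 1 - z * p ^ k) = (1 - z) * (\<Prod>k<n. 1 - (p * z) * p ^ k)" for n
    by (subst prod.lessThan_Suc_shift) (simp add: mult_ac)
  ultimately show ?thesis
    by (auto intro: LIMSEQ_unique)
qed

lemma qpoch_inf_nonzero:
  assumes "norm p < 1" "norm z < 1"
  shows "qpoch_inf z p \<noteq> 0"
proof
  assume "qpoch_inf z p = 0"
  then obtain k where k: "z * p ^ k = 1"
    using has_prod_eq_0_iff[OF qpoch_inf_has_prod[OF assms(1), of z]] by auto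
  have "norm (z * p ^ k) \<le> norm z"
    using assms(1) by (simp add: norm_mult norm_power mult_left_le power_le_one)
  with k assms(2) show False by simp
qed

text \<open>Serves the evaluation at the special point in \<open>Q_base\<close>: factors at opposite
  arguments merge into a single factor in base \<open>p\<^sup>2\<close>.\<close>

lemma qpoch_inf_minus:
  assumes "norm p < 1"
  shows "qpoch_inf z p * qpoch_inf (- z) p = qpoch_inf (z\<^sup>2) (p\<^sup>2)"
proof -
  have "norm (p\<^sup>2) < 1"
    using assms by (simp add: norm_power abs_square_less_1)
  then have "(\<lambda>n. \<Prod>k<n. 1 - z\<^sup>2 * (p\<^sup>2) ^ k) \<longlonglongrightarrow> qpoch_inf (z\<^sup>2) (p\<^sup>2)"
    by (rule qpoch_inf_tendsto)
  moreover have "(\<Prod>k<n. 1 - z\<^sup>2 * (p\<^sup>2) ^ k) = (\<Prod>k<n. 1 - z * p ^ k) * (\<Prod>k<n. 1 - (- z) * p ^ k)" for n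
    by (simp add: prod.distrib[symmetric] algebra_simps power2_eq_square power_mult_distrib)
  ultimately show ?thesis
    using tendsto_mult[OF qpoch_inf_tendsto[OF assms, of z] qpoch_inf_tendsto[OF assms, of "- z"]]
    by (auto intro: LIMSEQ_unique)
qed

text \<open>Splits the product by the parity of the exponent. In \<open>Q_base\<close> this cuts the
  numerator of the kernel into the base \<open>p\<^sup>2\<close> pieces that
  \<open>qpoch_inf_minus\<close> produces in the denominator.\<close>

lemma qpoch_inf_even_odd:
  assumes "norm p < 1"
  shows "qpoch_inf z (p\<^sup>2) * qpoch_inf (p * z) (p\<^sup>2) = qpoch_inf z p"
proof -
  have p2: "norm (p\<^sup>2) < 1"
    using assms by (simp add: norm_power abs_square_less_1)
  have "(\<lambda>n. \<Prod>k<2 * n. 1 - z * p ^ k) \<longlonglongrightarrow> qpoch_inf z p"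
    using LIMSEQ_subseq_LIMSEQ[OF qpoch_inf_tendsto[OF assms, of z], of "\<lambda>n. 2 * n"]
    by (simp add: strict_mono_def o_def)
  moreover have "(\<Prod>k<2 * n. 1 - z * p ^ k) =
      (\<Prod>k<n. 1 - z * (p\<^sup>2) ^ k) * (\<Prod>k<n. 1 - (p * z) * (p\<^sup>2) ^ k)" for n
    by (induction n) (simp_all add: power_mult[symmetric] mult_ac)
  ultimately show ?thesis
    using tendsto_mult[OF qpoch_inf_tendsto[OF p2, of z] qpoch_inf_tendsto[OF p2, of "p * z"]]
    by (auto intro: LIMSEQ_unique)
qed

text \<open>A locally uniform limit of polynomials: on the closed unit ball about \<open>x\<close>
  the terms \<open>z * p ^ k\<close> are dominated by a geometric series, and uniform convergence
  passes from the sum to the product.\<close>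

lemma qpoch_inf_holomorphic:
  assumes "norm p < 1"
  shows "(\<lambda>z. qpoch_inf z p) holomorphic_on UNIV"
proof (rule holomorphic_uniform_sequence)
  show "(\<lambda>z. \<Prod>k<n. 1 - z * p ^ k) holomorphic_on UNIV" for n
    by (intro holomorphic_intros)
  fix x :: complex
  have "uniformly_convergent_on (cball x 1) (\<lambda>n z. \<Sum>k<n. norm (- (z * p ^ k)))"
  proof (rule Weierstrass_m_test')
    show "summable (\<lambda>k. (norm x + 1) * norm p ^ k)"
      using assms by (intro summable_mult summable_geometric) auto
    fix k z assume "z \<in> cball x 1"
    then have "norm z \<le> norm x + 1"
      using norm_triangle_ineq2[of z x] by (auto simp: dist_norm norm_minus_commute)
    then show "norm (norm (- (z * p ^ k))) \<le> (norm x + 1) * norm p ^ k"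
      by (simp add: norm_mult norm_power mult_right_mono)
  qed
  then have "uniformly_convergent_on (cball x 1) (\<lambda>n z. \<Prod>k<n. 1 + - (z * p ^ k))"
    by (intro uniformly_convergent_on_prod continuous_intros) auto
  then have "uniform_limit (cball x 1) (\<lambda>n z. \<Prod>k<n. 1 - z * p ^ k)
      (\<lambda>z. lim (\<lambda>n. \<Prod>k<n. 1 - z * p ^ k)) sequentially"
    by (simp add: uniformly_convergent_uniform_limit_iff)
  moreover have "lim (\<lambda>n. \<Prod>k<n. 1 - z * p ^ k) = qpoch_inf z p" for z
    by (rule limI[OF qpoch_inf_tendsto[OF assms]])
  ultimately show "\<exists>d>0. cball x d \<subseteq> UNIV \<and>
      uniform_limit (cball x d) (\<lambda>n z. \<Prod>k<n. 1 - z * p ^ k) (\<lambda>z. qpoch_inf z p) sequentially"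
    by (intro exI[of _ 1]) auto
qed auto

lemma holomorphic_on_qpoch_inf [holomorphic_intros]:
  assumes "norm p < 1" "f holomorphic_on S"
  shows "(\<lambda>z. qpoch_inf (f z) p) holomorphic_on S"
  using holomorphic_on_compose[OF assms(2), of "\<lambda>z. qpoch_inf z p"]
    holomorphic_on_subset[OF qpoch_inf_holomorphic[OF assms(1)]]
  by (simp add: o_def)

lemma continuous_on_qpoch_inf [continuous_intros]:
  assumes "norm p < 1" "continuous_on S f"
  shows "continuous_on S (\<lambda>z. qpoch_inf (f z) p)"
  using holomorphic_on_imp_continuous_on[OF qpoch_inf_holomorphic[OF assms(1)]]
  by (rule continuous_on_compose2[OF _ assms(2)]) auto

section \<open>Means over the unit circle\<close>

definition circ_mean :: "(complex \<Rightarrow> complex) \<Rightarrow> complex" where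
  "circ_mean F = integral {0..1} (\<lambda>x. F (cis (2 * pi * x)))"

text \<open>On the unit circle \<open>dz / z\<close> is 2 pi i times \<open>dx\<close>. The constant
  can be pulled out for every \<open>F\<close>, since without integrability both sides take the
  default value.\<close>

lemma contour_integral_circlepath_circ_mean:
  "contour_integral (circlepath 0 1) (\<lambda>z. F z / z) = 2 * of_real pi * \<i> * circ_mean F"
proof -
  have "F (circlepath 0 1 x) / circlepath 0 1 x * vector_derivative (circlepath 0 1) (at x) =
      2 * of_real pi * \<i> * F (cis (2 * pi * x))" for x
    unfolding vector_derivative_circlepath by (simp add: circlepath cis_conv_exp mult_ac)
  then show ?thesis
    by (simp add: contour_integral_integral circ_mean_def integral_mult_right)
qed

lemma circ_mean_cong:
  assumes "\<And>z. norm z = 1 \<Longrightarrow> F z = G z"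
  shows "circ_mean F = circ_mean G"
  using assms by (simp add: circ_mean_def)

lemma circ_mean_add:
  assumes "continuous_on (sphere 0 1) F" "continuous_on (sphere 0 1) G"
  shows "circ_mean (\<lambda>z. F z + G z) = circ_mean F + circ_mean G"
  unfolding circ_mean_def
  by (intro integral_add integrable_continuous_real continuous_intros
      continuous_on_compose2[OF assms(1)] continuous_on_compose2[OF assms(2)]) auto

lemma circ_mean_cmult: "circ_mean (\<lambda>z. c * F z) = c * circ_mean F"
  by (simp add: circ_mean_def integral_mult_right)

lemma circ_mean_const: "circ_mean (\<lambda>z. c) = c"
  by (simp add: circ_mean_def)

text \<open>Inversion of the circle is \<open>x \<mapsto> 1 - x\<close> on the parameter interval, a
  reflection followed by a translation.\<close>

lemma circ_mean_inverse: "circ_mean (\<lambda>z. F (inverse z)) = circ_mean F"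
proof -
  have "circ_mean F = integral {- 1..- 0} (\<lambda>x. F (cis (2 * pi * - x)))"
    unfolding circ_mean_def by (rule Henstock_Kurzweil_Integration.integral_reflect_real[symmetric])
  also have "\<dots> = integral {0..1} (\<lambda>x. F (cis (2 * pi * (1 - x))))"
    using integral_shift_real_ivl[of "-1" "-1" 0 "\<lambda>x. F (cis (2 * pi * - x))"] by simp
  finally have "circ_mean F = \<dots>" .
  moreover have "cis (2 * pi * (1 - x)) = inverse (cis (2 * pi * x))" for x
    by (simp add: right_diff_distrib cis_divide[symmetric] divide_inverse)
  ultimately show ?thesis
    by (simp add: circ_mean_def)
qed

lemma circ_mean_disc:
  assumes "F holomorphic_on cball 0 1"
  shows "circ_mean F = F 0"
  using contour_integral_unique[OF Cauchy_integral_circlepath_simple[OF assms, of 0]]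
    contour_integral_circlepath_circ_mean[of F] by simp

text \<open>Composing with the exponential turns the annulus into a convex strip, where \<open>F \<circ> exp\<close>
  has a primitive \<open>g\<close>; all the means are its increment over one period.\<close>

lemma circ_mean_scale:
  assumes F: "F holomorphic_on {z. a < norm z \<and> norm z < b}"
    and a: "0 < a" and c: "a < norm c" "norm c < b" and b: "a < 1" "1 < b"
  shows "circ_mean (\<lambda>z. F (c * z)) = circ_mean F"
proof -
  define S where "S = {w. ln a < Re w \<and> Re w < ln b}"
  have S: "convex S" "open S"
  proof -
    have "S = {w. Re w > ln a} \<inter> {w. Re w < ln b}" by (auto simp: S_def)
    then show "convex S" "open S"
      by (auto intro!: convex_Int convex_halfspace_Re_gt convex_halfspace_Re_lt
          open_Int open_halfspace_Re_gt open_halfspace_Re_lt)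
  qed
  have S_iff: "w \<in> S \<longleftrightarrow> a < norm (exp w) \<and> norm (exp w) < b" for w
    using a b(2) exp_less_cancel_iff[of "ln a" "Re w"] exp_less_cancel_iff[of "Re w" "ln b"]
    by (simp add: S_def)
  have "(F \<circ> exp) holomorphic_on S"
    by (rule holomorphic_on_compose_gen[OF _ F]) (auto simp: S_iff holomorphic_on_exp)
  then obtain g where g: "\<And>w. w \<in> S \<Longrightarrow> (g has_field_derivative (F \<circ> exp) w) (at w within S)"
    using holomorphic_convex_primitive'[OF S] by blast
  have g': "(g has_field_derivative F (exp w)) (at w)" if "w \<in> S" for w
    using g[OF that] at_within_open[OF that S(2)] by simp
  define P :: complex where "P = 2 * of_real pi * \<i>"
  \<comment> \<open>Integer \<open>y\<close> gives the periods of \<open>exp\<close>; the other real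
    \<open>y\<close> give the points of the vertical segment from \<open>w\<close> to
    \<open>w + P\<close>, along which \<open>g\<close> is differentiated below.\<close>
  have shift: "w + y * P \<in> S" if "w \<in> S" "y \<in> \<real>" for w y
  proof -
    from that(2) obtain x where "y = of_real x" by (rule Reals_cases)
    with that(1) show ?thesis by (simp add: S_def P_def)
  qed
  have "\<exists>k. \<forall>w\<in>S. g (w + P) - g w = k"
  proof (rule has_field_derivative_zero_constant[OF S(1)])
    fix w assume w: "w \<in> S"
    have "((\<lambda>w. g (w + P)) has_field_derivative F (exp (w + P))) (at w)"
      using DERIV_shift[of g "F (exp (w + P))" w P] g'[OF shift[OF w, of 1]] by (simp add: add.commute)
    moreover have "exp (w + P) = exp w" by (simp add: P_def exp_add exp_two_pi_i mult_ac)
    ultimately show "((\<lambda>w. g (w + P) - g w) has_field_derivative 0) (at w within S)"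
      using DERIV_diff[OF _ g'[OF w]] by (metis diff_self has_field_derivative_at_within)
  qed
  then obtain k where k: "g (w + P) - g w = k" if "w \<in> S" for w by blast
  have mean: "circ_mean (\<lambda>z. F (exp w * z)) = k / P" if w: "w \<in> S" for w
  proof -
    have "((\<lambda>x. F (exp w * cis (2 * pi * x)) * P) has_integral (g (w + of_real 1 * P) - g (w + of_real 0 * P))) {0..1}"
    proof (rule fundamental_theorem_of_calculus)
      fix x :: real assume "x \<in> {0..1}"
      have "((\<lambda>y. w + y * P) has_field_derivative P) (at (of_real x))"
        by (auto intro!: derivative_eq_intros)
      then have "((\<lambda>y. g (w + y * P)) has_field_derivative F (exp (w + of_real x * P)) * P) (at (of_real x))"
        using g'[OF shift[OF w, of "of_real x"]] by (intro DERIV_chain2[of g]) simp_all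
      then have "((\<lambda>y. g (w + of_real y * P)) has_vector_derivative F (exp (w + of_real x * P)) * P) (at x)"
        by (rule has_vector_derivative_real_field)
      moreover have "exp (w + of_real x * P) = exp w * cis (2 * pi * x)"
        by (simp add: P_def exp_add cis_conv_exp mult_ac)
      ultimately show "((\<lambda>x. g (w + of_real x * P)) has_vector_derivative F (exp w * cis (2 * pi * x)) * P) (at x within {0..1})"
        by (simp only: has_vector_derivative_at_within)
    qed simp
    from integral_unique[OF this] have "circ_mean (\<lambda>z. F (exp w * z)) * P = k"
      using k[OF w] by (simp add: circ_mean_def)
    moreover have "P \<noteq> 0" by (simp add: P_def)
    ultimately show ?thesis by (simp add: eq_divide_eq)
  qed
  have "c \<noteq> 0" using a c by auto
  \<comment> \<open>The points \<open>Ln c\<close> and \<open>0\<close> of the strip lie over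
    \<open>c\<close> and \<open>1\<close>, and both give the same value
    \<open>k / P\<close>.\<close>
  then show ?thesis
    using mean[of "Ln c"] mean[of 0] c b by (simp add: S_iff)
qed

lemma circ_mean_continuous:
  assumes "continuous_on (U \<times> sphere 0 1) (\<lambda>(s, z). F s z)"
  shows "continuous_on U (\<lambda>s. circ_mean (F s))"
proof -
  have "continuous_on (U \<times> cbox 0 (1::real)) ((\<lambda>(s, z). F s z) \<circ> (\<lambda>(s, x). (s, cis (2 * pi * x))))"
    by (intro continuous_on_compose continuous_on_subset[OF assms])
       (auto simp: case_prod_unfold intro!: continuous_intros)
  then show ?thesis
    using integral_continuous_on_param[of U 0 "1::real" "\<lambda>s x. F s (cis (2 * pi * x))"]
    by (simp add: circ_mean_def case_prod_unfold o_def)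
qed

section \<open>The asymmetric Nassrallah--Rahman integral\<close>

lemma norm_mult_less_one:
  fixes x y :: complex
  assumes "norm x < 1" "norm y < 1"
  shows "norm (x * y) < 1"
  using mult_strict_mono[of "norm x" 1 "norm y" 1] assms by (simp add: norm_mult)

lemma one_minus_nonzero:
  fixes x :: complex
  assumes "norm x < 1"
  shows "1 - x \<noteq> 0"
  using assms by auto

text \<open>The algebraic core of \<open>kern_eq\<close>. Over a common denominator, the left side
  comes from the kernels at \<open>u * v * a\<close> and \<open>a\<close>, and the three products on
  the right from \<open>psi_dual\<close>, \<open>psi\<close> and \<open>kap\<close>. The parameter
  \<open>u\<close> is absent, because only factors of the form \<open>1 - x\<close> split off by one
  application of \<open>P_unfold\<close> remain.\<close>

lemma nassrallah_rahman_contiguity: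
  fixes a b c d e v z A :: complex
  assumes "A = a * b * c * d * e"
  shows "z * (1 - v * z\<^sup>2) *
      ((1 - a * c * d * e) * (1 - a * b * d * e) * (1 - v * (a * b * c * e)) * (1 - v * (a * b * c * d)) *
         (1 - v * a * z) * (z - a)
       - (1 - v * a * b) * (1 - v * a * c) * (1 - a * d) * (1 - a * e) * (1 - v * A * z) * (z - A)) =
    a * (1 - v * A * a) *
      (v * (1 - v * A * z) * (z - a) * (z - b) * (z - c) * (1 - d * z) * (1 - e * z)
       - (z - A) * (1 - v * a * z) * (1 - v * b * z) * (1 - v * c * z) * (1 - d * z) * (1 - e * z)
       - (v - d * e) * (1 - v * A * z) * (1 - v * z\<^sup>2) * (z - a) * (z - b) * (z - c))"
  unfolding assms by algebra

text \<open>Two independent bases make the setting closed under exchanging \<open>u\<close> and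
  \<open>v\<close>, as \<open>Q_swap\<close> requires; the pair \<open>q\<close>,
  \<open>q ^ (r - 1)\<close> alone is in general not closed under this.\<close>

locale nassrallah_rahman =
  fixes u v :: complex
  assumes norm_u: "norm u < 1" and norm_v: "norm v < 1"
begin

abbreviation P :: "complex \<Rightarrow> complex" where
  "P x \<equiv> qpoch_inf x (u * v)"

definition kern :: "complex \<Rightarrow> complex \<Rightarrow> complex \<Rightarrow> complex \<Rightarrow> complex \<Rightarrow> complex \<Rightarrow> complex" where
  "kern a b c d e z =
     P (v * (a * b * c * d * e) * z) * P (a * b * c * d * e / z) * P (v * z\<^sup>2) * P (u / z\<^sup>2) /
     (P (v * a * z) * P (a / z) * P (v * b * z) * P (b / z) * P (v * c * z) * P (c / z) *
      P (d * z) * P (u * d / z) * P (e * z) * P (u * e / z))"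

definition val :: "complex \<Rightarrow> complex \<Rightarrow> complex \<Rightarrow> complex \<Rightarrow> complex \<Rightarrow> complex" where
  "val a b c d e =
     P (b * c * d * e) * P (a * c * d * e) * P (a * b * d * e) *
       P (v * (a * b * c * e)) * P (v * (a * b * c * d)) /
     (P (v * a * b) * P (v * a * c) * P (v * b * c) *
      P (a * d) * P (a * e) * P (b * d) * P (b * e) * P (c * d) * P (c * e) * P (u * d * e))"

text \<open>The goal is that this quotient is \<open>1 / P (u * v)\<close> for all parameters in the
  unit disc. The factor \<open>P (u * v)\<close> is kept out of it, being independent of the
  parameters.\<close>

definition Q :: "complex \<Rightarrow> complex \<Rightarrow> complex \<Rightarrow> complex \<Rightarrow> complex \<Rightarrow> complex" where
  "Q a b c d e = circ_mean (kern a b c d e) / val a b c d e"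

definition kap :: "complex \<Rightarrow> complex \<Rightarrow> complex \<Rightarrow> complex \<Rightarrow> complex \<Rightarrow> complex \<Rightarrow> complex" where
  "kap a b c d e z =
     z * P (v * (a * b * c * d * e) * z) * P (u * v * (a * b * c * d * e / z)) * P (v * z\<^sup>2) * P (u / z\<^sup>2) /
     (P (v * a * z) * P (u * v * (a / z)) * P (v * b * z) * P (u * v * (b / z)) *
      P (v * c * z) * P (u * v * (c / z)) *
      P (d * z) * P (u * d / z) * P (e * z) * P (u * e / z))"

definition psi :: "complex \<Rightarrow> complex \<Rightarrow> complex \<Rightarrow> complex \<Rightarrow> complex \<Rightarrow> complex \<Rightarrow> complex" where
  "psi a b c d e z =
     P (u * v * (v * (a * b * c * d * e) * z)) * P (a * b * c * d * e / z) * P (u * v * (v * z\<^sup>2)) * P (u / z\<^sup>2) /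
     (z * P (u * v * (v * a * z)) * P (a / z) * P (u * v * (v * b * z)) * P (b / z) *
      P (u * v * (v * c * z)) * P (c / z) *
      P (u * v * (d * z)) * P (u * d / z) * P (u * v * (e * z)) * P (u * e / z))"

text \<open>For \<open>v \<noteq> 0\<close> and \<open>z \<noteq> 0\<close> this is
  \<open>psi\<close> at \<open>1 / (v * z)\<close>, written out so that it also makes sense for
  \<open>v = 0\<close>, where it vanishes.\<close>

definition psi_dual :: "complex \<Rightarrow> complex \<Rightarrow> complex \<Rightarrow> complex \<Rightarrow> complex \<Rightarrow> complex \<Rightarrow> complex" where
  "psi_dual a b c d e z =
     v * z * P (v * (a * b * c * d * e) * z) * P (u * v * (a * b * c * d * e / z)) *
       P (u * v * (v * z\<^sup>2)) * P (u / z\<^sup>2) /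
     (P (v * a * z) * P (u * v * (a / z)) * P (v * b * z) * P (u * v * (b / z)) *
      P (v * c * z) * P (u * v * (c / z)) *
      P (u * v * (d * z)) * P (u * d / z) * P (u * v * (e * z)) * P (u * e / z))"

section \<open>The contiguity relation for the kernel\<close>

lemma norm_uv: "norm (u * v) < 1"
  by (rule norm_mult_less_one[OF norm_u norm_v])

lemmas P_unfold = qpoch_inf_unfold[OF norm_uv]

lemmas P_nonzero = qpoch_inf_nonzero[OF norm_uv]

lemma val_nonzero:
  assumes "norm a < 1" "norm b < 1" "norm c < 1" "norm d < 1" "norm e < 1"
  shows "val a b c d e \<noteq> 0"
  using assms norm_u norm_v by (simp add: val_def P_nonzero norm_mult_less_one)

text \<open>All five functions are rational multiples of one product \<open>M\<close>, so the claim
  reduces to \<open>nassrallah_rahman_contiguity\<close>. The weights on the left are chosen so that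
  the product sides \<open>val\<close> cancel against each other in the same combination, which
  \<open>Q_shift\<close> uses.\<close>

lemma kern_eq:
  assumes z: "norm z = 1"
    and t: "norm a < 1" "norm b < 1" "norm c < 1" "norm d < 1" "norm e < 1"
  defines "A \<equiv> a * b * c * d * e"
  shows "(1 - a * c * d * e) * (1 - a * b * d * e) * (1 - v * (a * b * c * e)) * (1 - v * (a * b * c * d)) *
           kern (u * v * a) b c d e z
       - (1 - v * a * b) * (1 - v * a * c) * (1 - a * d) * (1 - a * e) * kern a b c d e z =
     a * (1 - v * A * a) * (psi_dual a b c d e z - psi a b c d e z - (v - d * e) * kap a b c d e z)"
proof -
  \<comment> \<open>Each factor occurring in both a shifted and an unshifted form enters
    \<open>M\<close> in its shifted form; the factors in \<open>u / z\<^sup>2\<close>,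
    \<open>u * d / z\<close> and \<open>u * e / z\<close> are common to all five functions.\<close>
  define M where "M =
     P (u * v * (v * A * z)) * P (u * v * (A / z)) * P (u * v * (v * z\<^sup>2)) * P (u / z\<^sup>2) /
     (P (u * v * (v * a * z)) * P (u * v * (a / z)) * P (u * v * (v * b * z)) * P (u * v * (b / z)) *
      P (u * v * (v * c * z)) * P (u * v * (c / z)) *
      P (u * v * (d * z)) * P (u * d / z) * P (u * v * (e * z)) * P (u * e / z))"
  have z0: "z \<noteq> 0" using z by auto
  have ne: "z - x \<noteq> 0" "1 - x * z \<noteq> 0" "1 - v * x * z \<noteq> 0" if "norm x < 1" for x
  proof -
    show "z - x \<noteq> 0" using that z by auto
    show "1 - x * z \<noteq> 0"
      using that z by (intro one_minus_nonzero) (simp add: norm_mult)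
    show "1 - v * x * z \<noteq> 0"
      using norm_mult_less_one[OF norm_v that] z by (intro one_minus_nonzero) (simp add: norm_mult)
  qed
  have inv: "1 - x / z = (z - x) / z" for x using z0 by (simp add: field_simps)
  define D where "D = (1 - v * a * z) * (1 - v * b * z) * (1 - v * c * z) * (z - a) * (z - b) * (z - c) *
    (1 - d * z) * (1 - e * z)"
  note facs = ne[OF t(1)] ne[OF t(2)] ne[OF t(3)] ne[OF t(4)] ne[OF t(5)]
  have D: "D \<noteq> 0" using facs by (simp add: D_def)
  note unf = P_unfold[of "v * A * z"] P_unfold[of "A / z"] P_unfold[of "v * z\<^sup>2"]
     P_unfold[of "v * a * z"] P_unfold[of "v * b * z"] P_unfold[of "v * c * z"]
     P_unfold[of "a / z"] P_unfold[of "b / z"] P_unfold[of "c / z"] P_unfold[of "d * z"] P_unfold[of "e * z"]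
  have A': "v * (u * v * a * b * c * d * e) * z = u * v * (v * A * z)"
    "u * v * a * b * c * d * e / z = u * v * (A / z)" "v * (u * v * a) * z = u * v * (v * a * z)"
    "u * v * a / z = u * v * (a / z)"
    by (simp_all add: A_def)
  \<comment> \<open>Replacing \<open>a\<close> by \<open>u * v * a\<close> also multiplies
    \<open>A\<close> by \<open>u * v\<close>, so no linear factor in \<open>a\<close> or
    \<open>A\<close> splits off; those in \<open>a\<close> are multiplied in only to reach the
    denominator \<open>D\<close>.\<close>
  have k1: "kern (u * v * a) b c d e z = M * (z\<^sup>2 * (1 - v * z\<^sup>2) * (1 - v * a * z) * (z - a) / D)"
  proof -
    have "kern (u * v * a) b c d e z = M * ((1 - v * z\<^sup>2) /
      ((1 - v * b * z) * (1 - b / z) * (1 - v * c * z) * (1 - c / z) * (1 - d * z) * (1 - e * z)))"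
      unfolding kern_def A' M_def unf(3,5,6,8-11) by (simp only: times_divide_times_eq mult_ac)
    also have "(1 - v * z\<^sup>2) /
      ((1 - v * b * z) * (1 - b / z) * (1 - v * c * z) * (1 - c / z) * (1 - d * z) * (1 - e * z)) =
       z\<^sup>2 * (1 - v * z\<^sup>2) * (1 - v * a * z) * (z - a) / D"
      using facs z0 unfolding inv D_def by (simp add: divide_simps power2_eq_square)
    finally show ?thesis .
  qed
  have k2: "kern a b c d e z = M * (z * (1 - v * z\<^sup>2) * (1 - v * A * z) * (z - A) * z / D)"
  proof -
    have "kern a b c d e z = M * ((1 - v * A * z) * (1 - A / z) * (1 - v * z\<^sup>2) /
      ((1 - v * a * z) * (1 - a / z) * (1 - v * b * z) * (1 - b / z) * (1 - v * c * z) * (1 - c / z) *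
        (1 - d * z) * (1 - e * z)))"
      unfolding kern_def A_def[symmetric] M_def unf by (simp only: times_divide_times_eq mult_ac)
    also have "(1 - v * A * z) * (1 - A / z) * (1 - v * z\<^sup>2) /
      ((1 - v * a * z) * (1 - a / z) * (1 - v * b * z) * (1 - b / z) * (1 - v * c * z) * (1 - c / z) *
        (1 - d * z) * (1 - e * z)) =
       z * (1 - v * z\<^sup>2) * (1 - v * A * z) * (z - A) * z / D"
      using facs z0 unfolding inv D_def by (simp add: divide_simps power2_eq_square)
    finally show ?thesis .
  qed
  have k3: "psi a b c d e z = M * (z * (z - A) * (1 - v * a * z) * (1 - v * b * z) * (1 - v * c * z) *
      (1 - d * z) * (1 - e * z) / D)"
  proof -
    have "psi a b c d e z = M * ((1 - A / z) / (z * (1 - a / z) * (1 - b / z) * (1 - c / z)))"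
      unfolding psi_def A_def[symmetric] M_def unf by (simp only: times_divide_times_eq mult_ac)
    also have "(1 - A / z) / (z * (1 - a / z) * (1 - b / z) * (1 - c / z)) =
      z * (z - A) * (1 - v * a * z) * (1 - v * b * z) * (1 - v * c * z) * (1 - d * z) * (1 - e * z) / D"
      using facs z0 unfolding inv D_def by (simp add: divide_simps)
    finally show ?thesis .
  qed
  have k4: "psi_dual a b c d e z = M * (z * v * (1 - v * A * z) * (z - a) * (z - b) * (z - c) *
      (1 - d * z) * (1 - e * z) / D)"
  proof -
    have "psi_dual a b c d e z = M * (v * z * (1 - v * A * z) / ((1 - v * a * z) * (1 - v * b * z) * (1 - v * c * z)))"
      unfolding psi_dual_def A_def[symmetric] M_def unf by (simp only: times_divide_times_eq mult_ac)
    also have "v * z * (1 - v * A * z) / ((1 - v * a * z) * (1 - v * b * z) * (1 - v * c * z)) =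
      z * v * (1 - v * A * z) * (z - a) * (z - b) * (z - c) * (1 - d * z) * (1 - e * z) / D"
      using facs z0 unfolding D_def by (simp add: divide_simps)
    finally show ?thesis .
  qed
  have k5: "kap a b c d e z = M * (z * (1 - v * A * z) * (1 - v * z\<^sup>2) * (z - a) * (z - b) * (z - c) / D)"
  proof -
    have "kap a b c d e z = M * (z * (1 - v * A * z) * (1 - v * z\<^sup>2) /
        ((1 - v * a * z) * (1 - v * b * z) * (1 - v * c * z) * (1 - d * z) * (1 - e * z)))"
      unfolding kap_def A_def[symmetric] M_def unf by (simp only: times_divide_times_eq mult_ac)
    also have "z * (1 - v * A * z) * (1 - v * z\<^sup>2) /
        ((1 - v * a * z) * (1 - v * b * z) * (1 - v * c * z) * (1 - d * z) * (1 - e * z)) =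
      z * (1 - v * A * z) * (1 - v * z\<^sup>2) * (z - a) * (z - b) * (z - c) / D"
      using facs z0 unfolding D_def by (simp add: divide_simps)
    finally show ?thesis .
  qed
  define K1 K2 where "K1 = (1 - v * a * b) * (1 - v * a * c) * (1 - a * d) * (1 - a * e)"
    and "K2 = (1 - a * c * d * e) * (1 - a * b * d * e) * (1 - v * (a * b * c * e)) * (1 - v * (a * b * c * d))"
  have "K2 * kern (u * v * a) b c d e z - K1 * kern a b c d e z =
    M * z / D * (z * (1 - v * z\<^sup>2) * (K2 * (1 - v * a * z) * (z - a) - K1 * (1 - v * A * z) * (z - A)))"
    unfolding k1 k2 using D by (simp add: field_simps power2_eq_square)
  also have "\<dots> = M * z / D * (a * (1 - v * A * a) *
      (v * (1 - v * A * z) * (z - a) * (z - b) * (z - c) * (1 - d * z) * (1 - e * z)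
       - (z - A) * (1 - v * a * z) * (1 - v * b * z) * (1 - v * c * z) * (1 - d * z) * (1 - e * z)
       - (v - d * e) * (1 - v * A * z) * (1 - v * z\<^sup>2) * (z - a) * (z - b) * (z - c)))"
    unfolding K1_def K2_def using nassrallah_rahman_contiguity[of A a b c d e z v] by (simp add: A_def)
  also have "\<dots> = a * (1 - v * A * a) * (psi_dual a b c d e z - psi a b c d e z - (v - d * e) * kap a b c d e z)"
    unfolding k3 k4 k5 by (simp only: times_divide_eq_right times_divide_eq_left diff_divide_distrib[symmetric])
      (simp only: algebra_simps)
  finally show ?thesis
    unfolding K1_def K2_def .
qed

lemma kern_nonzero:
  assumes "norm z = 1" "norm t < 1"
  shows "P (v * t * z) \<noteq> 0" "P (t / z) \<noteq> 0" "P (t * z) \<noteq> 0" "P (u * t / z) \<noteq> 0"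
proof -
  have "norm (v * t * z) = norm (v * t)" "norm (u * t / z) = norm (u * t)"
    "norm (t / z) = norm t" "norm (t * z) = norm t"
    using assms(1) by (simp_all add: norm_mult norm_divide)
  then show "P (v * t * z) \<noteq> 0" "P (t / z) \<noteq> 0" "P (t * z) \<noteq> 0" "P (u * t / z) \<noteq> 0"
    using assms(2) norm_mult_less_one[OF norm_v assms(2)] norm_mult_less_one[OF norm_u assms(2)]
    by (simp_all only: P_nonzero not_False_eq_True)
qed

lemma continuous_on_kern:
  assumes "continuous_on S f" "continuous_on S g" "norm b < 1" "norm c < 1" "norm d < 1" "norm e < 1"
    and "\<And>x. x \<in> S \<Longrightarrow> norm (f x) < 1" "\<And>x. x \<in> S \<Longrightarrow> norm (g x) = 1"
  shows "continuous_on S (\<lambda>x. kern (f x) b c d e (g x))"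
proof -
  have "g x \<noteq> 0" if "x \<in> S" for x using assms(8)[OF that] by auto
  then show ?thesis
    unfolding kern_def using assms
    by (intro continuous_intros norm_uv) (auto simp: kern_nonzero)
qed

section \<open>Means of the auxiliary functions\<close>

lemma norm_annulus:
  fixes t z :: complex
  assumes "norm t \<le> m" "0 < m" "norm z < 1 / m"
  shows "norm (t * z) < 1"
proof -
  have "norm t * norm z \<le> m * norm z" by (rule mult_right_mono) (use assms in auto)
  also have "\<dots> < 1" using assms by (simp add: field_simps)
  finally show ?thesis by (simp add: norm_mult)
qed

text \<open>For \<open>u \<noteq> 0\<close> the poles satisfy \<open>norm z \<le> norm u * m\<close>
  or \<open>norm z \<ge> 1 / m\<close> with \<open>m < 1\<close>, so the circle may be moved to
  radius \<open>norm u\<close>. The inversion \<open>z \<mapsto> u / z\<close> brings it back and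
  changes the sign of \<open>kap\<close>, so the mean is its own negative.\<close>

lemma circ_mean_kap:
  assumes t: "norm a < 1" "norm b < 1" "norm c < 1" "norm d < 1" "norm e < 1"
  shows "circ_mean (kap a b c d e) = 0"
proof -
  \<comment> \<open>The entry \<open>1 / 2\<close> keeps \<open>m\<close> positive when all
    parameters vanish, so that \<open>1 / m\<close> is meaningful and the inner radius of the
    annulus is positive for \<open>u \<noteq> 0\<close>.\<close>
  define m where "m = Max {norm a, norm b, norm c, norm d, norm e, 1 / 2}"
  have m: "norm a \<le> m" "norm b \<le> m" "norm c \<le> m" "norm d \<le> m" "norm e \<le> m" "1 / 2 \<le> m"
    by (simp_all add: m_def)
  then have m0: "0 < m" by linarith
  have m1: "m < 1" using t by (simp add: m_def)
  have nz: "P (v * t * z) \<noteq> 0" "P (t * z) \<noteq> 0" if "norm t \<le> m" "norm z < 1 / m" for t z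
  proof -
    have *: "norm (t * z) < 1" using norm_annulus that m0 by blast
    show "P (t * z) \<noteq> 0" using * by (rule P_nonzero)
    show "P (v * t * z) \<noteq> 0"
      using norm_mult_less_one[OF norm_v *] by (simp add: P_nonzero mult.assoc)
  qed
  show ?thesis
  proof (cases "u = 0")
    \<comment> \<open>All factors in \<open>1 / z\<close> become \<open>1\<close>, leaving a
      function holomorphic on the closed disc that vanishes at \<open>0\<close> through its factor
      \<open>z\<close>.\<close>
    case True
    have z: "norm z < 1 / m" if "z \<in> cball 0 1" for z :: complex
    proof (rule le_less_trans)
      show "norm z \<le> 1" using that by simp
      show "1 < 1 / m" using m0 m1 by simp
    qed
    have "circ_mean (kap a b c d e) = circ_mean (\<lambda>z. z * P (v * (a * b * c * d * e) * z) * P (v * z\<^sup>2) /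
      (P (v * a * z) * P (v * b * z) * P (v * c * z) * P (d * z) * P (e * z)))"
      unfolding kap_def using True by simp
    also have "\<dots> = 0"
    proof (subst circ_mean_disc)
      show "(\<lambda>z. z * P (v * (a * b * c * d * e) * z) * P (v * z\<^sup>2) /
        (P (v * a * z) * P (v * b * z) * P (v * c * z) * P (d * z) * P (e * z))) holomorphic_on cball 0 1"
        using m norm_uv by (intro holomorphic_intros) (simp_all only: mult_eq_0_iff nz z de_Morgan_disj not_False_eq_True simp_thms)
    qed simp
    finally show ?thesis .
  next
    case False
    have nz': "P (u * v * (t / z)) \<noteq> 0" "P (u * t / z) \<noteq> 0" if "norm t \<le> m" "norm u * m < norm z" for t z
    proof -
      have "norm u * norm t \<le> norm u * m" using that by (simp add: mult_left_mono)
      moreover have "0 \<le> norm u * m" using m0 by simp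
      ultimately have "norm u * norm t < norm z" "0 < norm z" using that by linarith+
      then have *: "norm (u * t / z) < 1" by (simp add: norm_mult norm_divide divide_less_eq)
      then show "P (u * t / z) \<noteq> 0" by (rule P_nonzero)
      show "P (u * v * (t / z)) \<noteq> 0"
        using norm_mult_less_one[OF norm_v *] by (simp add: P_nonzero mult_ac)
    qed
    have hol: "kap a b c d e holomorphic_on {z. norm u * m < norm z \<and> norm z < 1 / m}"
    proof -
      have "0 \<le> norm u * m" using m0 by simp
      then have zne: "z \<noteq> 0" if "norm u * m < norm z" for z :: complex using that by auto
      show ?thesis
        unfolding kap_def using m norm_uv
        by (intro holomorphic_intros) (simp_all only: mem_Collect_eq mult_eq_0_iff power_eq_0_iff
            nz nz' zne de_Morgan_disj not_False_eq_True simp_thms)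
    qed
    have um: "norm u * m < norm u" using False m1 by simp
    have "1 < 1 / m" using m0 m1 by simp
    moreover from this have "norm u < 1 / m" using norm_u by linarith
    moreover have "norm u * m < 1" using um norm_u by linarith
    moreover have "0 < norm u * m" using False m0 by simp
    ultimately have "circ_mean (kap a b c d e) = circ_mean (\<lambda>z. kap a b c d e (u * z))"
      using um by (intro circ_mean_scale[OF hol, symmetric])
    also have "\<dots> = circ_mean (\<lambda>z. kap a b c d e (u * inverse z))"
      by (rule circ_mean_inverse[symmetric])
    also have "\<dots> = circ_mean (\<lambda>z. - 1 * kap a b c d e z)"
    proof (rule circ_mean_cong)
      fix z :: complex assume "norm z = 1"
      then have z: "z \<noteq> 0" by auto
      define A where "A = a * b * c * d * e"
      have s: "v * t * (u * inverse z) = u * v * (t / z)" "u * v * (t / (u * inverse z)) = v * t * z"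
        "t * (u * inverse z) = u * t / z" "u * t / (u * inverse z) = t * z" for t
        using z False by (simp_all add: field_simps)
      have q: "u / (u * inverse z)\<^sup>2 = z\<^sup>2 / u" "v * (u * inverse z)\<^sup>2 = u * v * (u / z\<^sup>2)"
        "u * v * (z\<^sup>2 / u) = v * z\<^sup>2"
        using z False by (simp_all add: field_simps power2_eq_square)
      define D where "D = P (v * a * z) * P (u * v * (a / z)) * P (v * b * z) * P (u * v * (b / z)) *
        P (v * c * z) * P (u * v * (c / z)) * P (d * z) * P (u * d / z) * P (e * z) * P (u * e / z)"
      define N where "N = P (v * A * z) * P (u * v * (A / z)) * P (v * z\<^sup>2) * P (u * v * (u / z\<^sup>2))"
      have "kap a b c d e (u * inverse z) = u * inverse z * (1 - z\<^sup>2 / u) * (N / D)"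
        unfolding kap_def s q P_unfold[of "z\<^sup>2 / u"] N_def D_def A_def
        by (simp only: times_divide_eq_right mult_ac)
      \<comment> \<open>The sign arises here: the other factors are permuted by the inversion, while
        \<open>P (z\<^sup>2 / u)\<close> and \<open>P (u / z\<^sup>2)\<close> each lose one linear
        factor.\<close>
      also have "u * inverse z * (1 - z\<^sup>2 / u) = - 1 * (z * (1 - u / z\<^sup>2))"
        using z False by (simp add: field_simps power2_eq_square)
      also have "- 1 * (z * (1 - u / z\<^sup>2)) * (N / D) = - 1 * kap a b c d e z"
        unfolding kap_def P_unfold[of "u / z\<^sup>2"] N_def D_def A_def
        by (simp only: times_divide_eq_right mult_ac)
      finally show "kap a b c d e (u * inverse z) = - 1 * kap a b c d e z" .
    qed
    also have "\<dots> = - 1 * circ_mean (kap a b c d e)"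
      by (rule circ_mean_cmult)
    finally show ?thesis by simp
  qed
qed

text \<open>For \<open>v \<noteq> 0\<close> the poles of \<open>psi\<close> satisfy
  \<open>norm z \<le> m\<close> or \<open>norm z \<ge> 1 / (m * norm v)\<close>. The circle may thus
  be moved to radius \<open>1 / norm v\<close>, and inversion then turns \<open>psi\<close> into
  \<open>psi_dual\<close>.\<close>

lemma circ_mean_psi_dual:
  assumes t: "norm a < 1" "norm b < 1" "norm c < 1" "norm d < 1" "norm e < 1"
  shows "circ_mean (psi_dual a b c d e) = circ_mean (psi a b c d e)"
proof -
  define m where "m = Max {norm a, norm b, norm c, norm d, norm e, 1 / 2}"
  have m: "norm a \<le> m" "norm b \<le> m" "norm c \<le> m" "norm d \<le> m" "norm e \<le> m" "1 / 2 \<le> m"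
    by (simp_all add: m_def)
  then have m0: "0 < m" by linarith
  have m1: "m < 1" using t by (simp add: m_def)
  show ?thesis
  proof (cases "v = 0")
    case True
    have nz: "P (t * z) \<noteq> 0" "P (u * (t * z)) \<noteq> 0" if "norm t < 1" "z \<in> cball 0 1" for t z
    proof -
      have "norm (t * z) \<le> norm t" using that by (simp add: norm_mult mult_left_le)
      with that have *: "norm (t * z) < 1" by linarith
      show "P (t * z) \<noteq> 0" using * by (rule P_nonzero)
      show "P (u * (t * z)) \<noteq> 0" using norm_mult_less_one[OF norm_u *] by (rule P_nonzero)
    qed
    \<comment> \<open>For \<open>v = 0\<close> only factors in \<open>1 / z\<close> survive in
      \<open>psi\<close>. After inversion the integrand is holomorphic on the closed disc and
      vanishes at \<open>0\<close>; \<open>psi_dual\<close> is zero, so both means are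
      \<open>0\<close>.\<close>
    have "circ_mean (psi a b c d e) = circ_mean (\<lambda>z. psi a b c d e (inverse z))"
      by (rule circ_mean_inverse[symmetric])
    also have "\<dots> = circ_mean (\<lambda>z. z * P (a * b * c * d * e * z) * P (u * z\<^sup>2) /
      (P (a * z) * P (b * z) * P (c * z) * P (u * (d * z)) * P (u * (e * z))))"
      unfolding psi_def using True by (simp add: divide_inverse power_inverse mult_ac)
    also have "\<dots> = 0"
    proof (subst circ_mean_disc)
      show "(\<lambda>z. z * P (a * b * c * d * e * z) * P (u * z\<^sup>2) /
        (P (a * z) * P (b * z) * P (c * z) * P (u * (d * z)) * P (u * (e * z)))) holomorphic_on cball 0 1"
        using t norm_uv by (intro holomorphic_intros) (simp_all only: mult_eq_0_iff nz de_Morgan_disj not_False_eq_True simp_thms)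
    qed simp
    also have "circ_mean (psi_dual a b c d e) = 0"
    proof -
      have "psi_dual a b c d e z = 0" for z
        unfolding psi_dual_def by (simp add: True)
      then show ?thesis by (simp add: circ_mean_const cong: circ_mean_cong)
    qed
    finally show ?thesis by simp
  next
    case False
    have hol: "psi a b c d e holomorphic_on {z. m < norm z \<and> norm z < 1 / (m * norm v)}"
    proof -
      have nz: "P (u * v * (v * t * z)) \<noteq> 0" "P (t / z) \<noteq> 0" "P (u * v * (t * z)) \<noteq> 0" "P (u * t / z) \<noteq> 0"
        if "norm t \<le> m" "m < norm z" "norm z < 1 / (m * norm v)" for t z
      proof -
        have "norm (t * (v * z)) < 1"
          using that m0 False by (intro norm_annulus[of t m]) (auto simp: norm_mult field_simps)
        then have *: "norm (v * t * z) < 1" by (simp add: mult_ac)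
        show "P (u * v * (v * t * z)) \<noteq> 0"
          using norm_mult_less_one[OF norm_uv *] by (rule P_nonzero)
        show "P (u * v * (t * z)) \<noteq> 0"
          using norm_mult_less_one[OF norm_u *] by (simp add: P_nonzero mult_ac)
        have "norm t < norm z" "z \<noteq> 0" using that m0 by auto
        then have **: "norm (t / z) < 1" by (simp add: norm_divide divide_less_eq)
        show "P (t / z) \<noteq> 0" using ** by (rule P_nonzero)
        show "P (u * t / z) \<noteq> 0"
          using norm_mult_less_one[OF norm_u **] by (simp add: P_nonzero)
      qed
      show ?thesis
        unfolding psi_def using m norm_uv m0
        by (intro holomorphic_intros) (auto simp: nz)
    qed
    have mv: "m * norm v < norm v" "m * norm v < 1" using False m0 m1 norm_v mult_strict_mono[of m 1 "norm v" 1]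
      by auto
    have "circ_mean (psi a b c d e) = circ_mean (\<lambda>z. psi a b c d e (1 / v * z))"
      using m0 m1 False mv norm_v
      by (intro circ_mean_scale[OF hol, symmetric])
         (auto simp: norm_divide field_simps)
    also have "\<dots> = circ_mean (\<lambda>z. psi a b c d e (1 / v * inverse z))"
      by (rule circ_mean_inverse[symmetric])
    also have "\<dots> = circ_mean (psi_dual a b c d e)"
    proof (rule circ_mean_cong)
      fix z :: complex assume "norm z = 1"
      then have z: "z \<noteq> 0" by auto
      have s: "u * v * (v * t * (1 / v * inverse z)) = u * v * (t / z)" "t / (1 / v * inverse z) = v * t * z"
        "u * v * (t * (1 / v * inverse z)) = u * t / z" "u * t / (1 / v * inverse z) = u * v * (t * z)" for t
        using z False by (simp_all add: field_simps)
      have q: "u / (1 / v * inverse z)\<^sup>2 = u * v * (v * z\<^sup>2)" "u * v * (v * (1 / v * inverse z)\<^sup>2) = u / z\<^sup>2"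
        using z False by (simp_all add: field_simps power2_eq_square)
      have e: "x / (1 / v * inverse z * y) = v * z * x / y" for x y
        using z False by (simp add: field_simps)
      show "psi a b c d e (1 / v * inverse z) = psi_dual a b c d e z"
        unfolding psi_def psi_dual_def s q mult.assoc[of "1 / v * inverse z"] e
        by (simp only: times_divide_eq_right mult_ac)
    qed
    finally show ?thesis ..
  qed
qed

section \<open>Independence of the first three parameters\<close>

lemma shifted_nonzero:
  assumes z: "norm z = 1" and t: "norm t < 1"
  shows "P (u * v * (v * t * z)) \<noteq> 0" "P (u * v * t / z) \<noteq> 0" "P (u * v * (t * z)) \<noteq> 0"
proof -
  have *: "norm (u * v * x) < 1" if "norm x < 1" for x
    using norm_mult_less_one[OF norm_uv that] .
  have "norm (v * t * z) < 1" "norm (t / z) < 1" "norm (t * z) < 1"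
    using norm_mult_less_one[OF norm_v t] t z by (simp_all add: norm_mult norm_divide)
  from this[THEN *, THEN P_nonzero]
  show "P (u * v * (v * t * z)) \<noteq> 0" "P (u * v * t / z) \<noteq> 0" "P (u * v * (t * z)) \<noteq> 0"
    by (simp_all only: times_divide_eq_right not_False_eq_True)
qed

text \<open>Taking means in \<open>kern_eq\<close>, the \<open>psi\<close> terms cancel and the
  \<open>kap\<close> term vanishes. The mean therefore gets the factor \<open>K1 / K2\<close> under
  the shift, and \<open>val\<close> gets the same factor by unfolding its eight factors that contain
  \<open>a\<close>.\<close>

lemma Q_shift:
  assumes t: "norm a < 1" "norm b < 1" "norm c < 1" "norm d < 1" "norm e < 1"
  shows "Q (u * v * a) b c d e = Q a b c d e"
proof -
  define K1 K2 where "K1 = (1 - v * a * b) * (1 - v * a * c) * (1 - a * d) * (1 - a * e)"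
    and "K2 = (1 - a * c * d * e) * (1 - a * b * d * e) * (1 - v * (a * b * c * e)) * (1 - v * (a * b * c * d))"
  define C where "C = a * (1 - v * (a * b * c * d * e) * a)"
  have K1: "K1 \<noteq> 0"
    unfolding K1_def mult_eq_0_iff de_Morgan_disj
    using t norm_v by (intro conjI one_minus_nonzero norm_mult_less_one)
  have K2: "K2 \<noteq> 0"
    unfolding K2_def mult_eq_0_iff de_Morgan_disj
    using t norm_v by (intro conjI one_minus_nonzero norm_mult_less_one)
  have pa: "norm (u * v * a) < 1" by (rule norm_mult_less_one[OF norm_uv t(1)])
  have ck: "continuous_on (sphere 0 1) (kern s b c d e)" if "norm s < 1" for s
    using continuous_on_kern[of "sphere 0 1" "\<lambda>_. s" "\<lambda>z. z" b c d e] that t by (simp add: continuous_intros)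
  note nz = kern_nonzero[OF _ t(1)] kern_nonzero[OF _ t(2)] kern_nonzero[OF _ t(3)]
    kern_nonzero[OF _ t(4)] kern_nonzero[OF _ t(5)]
    shifted_nonzero[OF _ t(1)] shifted_nonzero[OF _ t(2)] shifted_nonzero[OF _ t(3)]
    shifted_nonzero[OF _ t(4)] shifted_nonzero[OF _ t(5)]
  have cp: "continuous_on (sphere 0 1) (psi a b c d e)"
    unfolding psi_def using norm_uv
    by (intro continuous_intros) (auto simp: nz)
  have cd: "continuous_on (sphere 0 1) (psi_dual a b c d e)"
    unfolding psi_dual_def using norm_uv
    by (intro continuous_intros) (auto simp: nz)
  have cl: "continuous_on (sphere 0 1) (kap a b c d e)"
    unfolding kap_def using norm_uv
    by (intro continuous_intros) (auto simp: nz)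
  \<comment> \<open>Differences are written as sums with negated coefficients, to match
    \<open>circ_mean_add\<close> and \<open>circ_mean_cmult\<close>.\<close>
  have "circ_mean (\<lambda>z. K2 * kern (u * v * a) b c d e z + (- K1) * kern a b c d e z) =
      circ_mean (\<lambda>z. C * psi_dual a b c d e z + ((- C) * psi a b c d e z + (- C * (v - d * e)) * kap a b c d e z))"
  proof (rule circ_mean_cong)
    fix z :: complex assume z: "norm z = 1"
    show "K2 * kern (u * v * a) b c d e z + (- K1) * kern a b c d e z =
      C * psi_dual a b c d e z + ((- C) * psi a b c d e z + (- C * (v - d * e)) * kap a b c d e z)"
      using kern_eq[OF z t] unfolding K1_def[symmetric] K2_def[symmetric] C_def[symmetric]
      by (simp add: algebra_simps)
  qed
  then have "K2 * circ_mean (kern (u * v * a) b c d e) = K1 * circ_mean (kern a b c d e)"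
    using ck[OF t(1)] ck[OF pa] cp cd cl
    by (simp only: circ_mean_add circ_mean_cmult continuous_on_add continuous_on_mult continuous_on_const
          circ_mean_psi_dual[OF t] circ_mean_kap[OF t]) (simp add: algebra_simps)
  moreover have "K2 * val (u * v * a) b c d e = K1 * val a b c d e"
  proof -
    note unf = P_unfold[of "a * c * d * e"] P_unfold[of "a * b * d * e"] P_unfold[of "v * (a * b * c * e)"]
      P_unfold[of "v * (a * b * c * d)"] P_unfold[of "v * a * b"] P_unfold[of "v * a * c"]
      P_unfold[of "a * d"] P_unfold[of "a * e"]
    define N where "N = P (b * c * d * e) * P (u * v * (a * c * d * e)) * P (u * v * (a * b * d * e)) *
       P (u * v * (v * (a * b * c * e))) * P (u * v * (v * (a * b * c * d))) /
     (P (u * v * (v * a * b)) * P (u * v * (v * a * c)) * P (v * b * c) *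
      P (u * v * (a * d)) * P (u * v * (a * e)) * P (b * d) * P (b * e) * P (c * d) * P (c * e) * P (u * d * e))"
    have "val (u * v * a) b c d e = N"
      unfolding val_def N_def by (simp only: mult_ac)
    moreover have "val a b c d e = K2 / K1 * N"
      unfolding val_def N_def unf K1_def K2_def by (simp only: times_divide_times_eq mult_ac)
    ultimately show ?thesis using K1 by simp
  qed
  ultimately have "circ_mean (kern (u * v * a) b c d e) = K1 / K2 * circ_mean (kern a b c d e)"
    "val (u * v * a) b c d e = K1 / K2 * val a b c d e"
    using K2 by (simp_all add: field_simps)
  then show ?thesis
    using K1 K2 by (simp add: Q_def)
qed

text \<open>\<open>Q\<close> is constant along the sequence \<open>(u * v) ^ n * a\<close>, which
  tends to \<open>0\<close>, and it is continuous in its first argument on the unit disc.\<close>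

lemma Q_zero:
  assumes t: "norm a < 1" "norm b < 1" "norm c < 1" "norm d < 1" "norm e < 1"
  shows "Q a b c d e = Q 0 b c d e"
proof -
  have "continuous_on (ball 0 1) (\<lambda>s. circ_mean (kern s b c d e))"
  proof (rule circ_mean_continuous)
    have "continuous_on (ball 0 1 \<times> sphere 0 1) (\<lambda>x. kern (fst x) b c d e (snd x))"
      using t by (intro continuous_on_kern continuous_intros) auto
    then show "continuous_on (ball 0 1 \<times> sphere 0 1) (\<lambda>(s, z). kern s b c d e z)"
      by (simp add: case_prod_unfold)
  qed
  moreover have "continuous_on (ball 0 1) (\<lambda>s. val s b c d e)"
    unfolding val_def
    using t norm_u norm_v norm_uv
    by (intro continuous_intros) (simp_all add: P_nonzero norm_mult_less_one)
  ultimately have "continuous_on (ball 0 1) (\<lambda>s. Q s b c d e)"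
    unfolding Q_def using t val_nonzero by (intro continuous_intros) auto
  then have "isCont (\<lambda>s. Q s b c d e) 0"
    by (simp add: continuous_on_eq_continuous_at)
  moreover have "(\<lambda>n. (u * v) ^ n * a) \<longlonglongrightarrow> 0"
    using tendsto_mult_left_zero[OF LIMSEQ_power_zero[OF norm_uv]] by simp
  ultimately have "(\<lambda>n. Q ((u * v) ^ n * a) b c d e) \<longlonglongrightarrow> Q 0 b c d e"
    by (rule isCont_tendsto_compose)
  moreover have "norm ((u * v) ^ n * a) < 1 \<and> Q ((u * v) ^ n * a) b c d e = Q a b c d e" for n
  proof (induction n)
    case (Suc n)
    then show ?case
      using Q_shift[of "(u * v) ^ n * a"] norm_mult_less_one[OF norm_uv, of "(u * v) ^ n * a"] t
      by (simp add: mult.assoc)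
  qed (use t in simp)
  ultimately show ?thesis
    using LIMSEQ_unique[OF tendsto_const] by simp
qed

text \<open>These two transpositions generate all permutations of \<open>a\<close>,
  \<open>b\<close>, \<open>c\<close>, so \<open>Q_zero\<close> reaches each of the three
  slots.\<close>

lemma Q_commute: "Q a b c d e = Q b a c d e" "Q a b c d e = Q a c b d e"
proof -
  have "kern a b c d e = kern b a c d e"
    by (rule ext) (simp only: kern_def mult_ac)
  moreover have "kern a b c d e = kern a c b d e"
    by (rule ext) (simp only: kern_def mult_ac)
  moreover have "val a b c d e = val b a c d e" "val a b c d e = val a c b d e"
    unfolding val_def by (simp_all only: mult_ac)
  ultimately show "Q a b c d e = Q b a c d e" "Q a b c d e = Q a c b d e"
    by (simp_all add: Q_def)
qed

lemma Q_zero3: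
  assumes "norm a < 1" "norm b < 1" "norm c < 1" "norm d < 1" "norm e < 1"
  shows "Q a b c d e = Q 0 0 0 d e"
proof -
  have "Q a b c d e = Q 0 b c d e" using assms by (intro Q_zero)
  also have "\<dots> = Q b 0 c d e" by (rule Q_commute(1))
  also have "\<dots> = Q 0 0 c d e" using assms by (intro Q_zero) auto
  also have "\<dots> = Q 0 c 0 d e" by (rule Q_commute(2))
  also have "\<dots> = Q c 0 0 d e" by (rule Q_commute(1))
  also have "\<dots> = Q 0 0 0 d e" using assms by (intro Q_zero) auto
  finally show ?thesis .
qed

end

section \<open>Exchange of the two groups of parameters, and the constant\<close>

lemma nassrallah_rahman_swap: "nassrallah_rahman u v \<Longrightarrow> nassrallah_rahman v u"
  by (simp add: nassrallah_rahman_def)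

text \<open>With \<open>c = 0\<close> the factors containing \<open>A\<close> are \<open>1\<close>.
  Under \<open>z \<mapsto> 1 / z\<close> the pair \<open>P (v * a * z)\<close>,
  \<open>P (a / z)\<close> takes the form of the pair \<open>P (d * z)\<close>,
  \<open>P (u * d / z)\<close> with \<open>u\<close> and \<open>v\<close> exchanged, and
  conversely.\<close>

lemma (in nassrallah_rahman) Q_swap:
  "Q a b 0 d e = nassrallah_rahman.Q v u d e 0 a b"
proof -
  interpret swap: nassrallah_rahman v u
    by (rule nassrallah_rahman_swap) unfold_locales
  have "circ_mean (kern a b 0 d e) = circ_mean (\<lambda>z. kern a b 0 d e (inverse z))"
    by (rule circ_mean_inverse[symmetric])
  also have "\<dots> = circ_mean (swap.kern d e 0 a b)"
    by (rule circ_mean_cong)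
       (simp add: kern_def swap.kern_def divide_inverse power_inverse mult_ac)
  finally show ?thesis
    by (simp add: Q_def swap.Q_def val_def swap.val_def mult_ac)
qed

context nassrallah_rahman
begin

text \<open>\<open>Q_zero3\<close> removes \<open>a\<close>, \<open>b\<close>, \<open>c\<close>; the
  exchange moves \<open>d\<close>, \<open>e\<close> into the first two slots, where
  \<open>Q_zero3\<close> for the exchanged bases removes them as well.\<close>

lemma Q_const:
  assumes t: "norm a < 1" "norm b < 1" "norm c < 1" "norm d < 1" "norm e < 1"
  shows "Q a b c d e = nassrallah_rahman.Q v u 0 0 0 0 0"
proof -
  interpret swap: nassrallah_rahman v u
    by (rule nassrallah_rahman_swap) unfold_locales
  have "Q a b c d e = Q 0 0 0 d e" by (rule Q_zero3[OF t])
  also have "\<dots> = swap.Q d e 0 0 0" by (rule Q_swap)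
  also have "\<dots> = swap.Q 0 0 0 0 0" using t by (intro swap.Q_zero3) auto
  finally show ?thesis .
qed

text \<open>Since \<open>A = 0\<close>, only the quadratic factors stay in the numerator of the
  kernel. Opposite parameters combine into four factors in base \<open>p\<^sup>2\<close>, exactly
  those into which the numerator splits. The norm bounds allow \<open>Q_const\<close> to be applied
  at this point.\<close>

lemma Q_base:
  assumes s: "s\<^sup>2 = u" and w: "w\<^sup>2 = v"
  shows "P (u * v) * Q s (- s) 0 w (- w) = 1" and "norm s < 1" and "norm w < 1"
proof -
  define p where "p = u * v"
  have p: "norm p < 1" using norm_uv by (simp add: p_def)
  then have p2: "norm (p\<^sup>2) < 1" by (simp add: norm_power abs_square_less_1)
  have "norm (s\<^sup>2) < 1" "norm (w\<^sup>2) < 1" using s w norm_u norm_v by auto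
  then show ns: "norm s < 1" and nw: "norm w < 1" by (simp_all add: norm_power abs_square_less_1)
  have "circ_mean (kern s (- s) 0 w (- w)) = circ_mean (\<lambda>z. 1)"
  proof (rule circ_mean_cong)
    fix z :: complex assume z: "norm z = 1"
    let ?R = "\<lambda>x. qpoch_inf x (p\<^sup>2)"
    have num: "qpoch_inf (v * z\<^sup>2) p = ?R (v * z\<^sup>2) * ?R (p * (v * z\<^sup>2))"
      "qpoch_inf (u / z\<^sup>2) p = ?R (u / z\<^sup>2) * ?R (p * (u / z\<^sup>2))"
      by (rule qpoch_inf_even_odd[OF p, symmetric])+
    have den: "qpoch_inf (v * s * z) p * qpoch_inf (- (v * s * z)) p = ?R (p * (v * z\<^sup>2))"
      "qpoch_inf (s / z) p * qpoch_inf (- (s / z)) p = ?R (u / z\<^sup>2)"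
      "qpoch_inf (w * z) p * qpoch_inf (- (w * z)) p = ?R (v * z\<^sup>2)"
      "qpoch_inf (u * w / z) p * qpoch_inf (- (u * w / z)) p = ?R (p * (u / z\<^sup>2))"
    proof -
      have "(v * s * z)\<^sup>2 = p * (v * z\<^sup>2)" "(s / z)\<^sup>2 = u / z\<^sup>2" "(w * z)\<^sup>2 = v * z\<^sup>2"
        "(u * w / z)\<^sup>2 = p * (u / z\<^sup>2)"
        using s w by (simp_all add: p_def power_mult_distrib power_divide power2_eq_square[of u] power2_eq_square[of v])
      then show "qpoch_inf (v * s * z) p * qpoch_inf (- (v * s * z)) p = ?R (p * (v * z\<^sup>2))"
      "qpoch_inf (s / z) p * qpoch_inf (- (s / z)) p = ?R (u / z\<^sup>2)"
      "qpoch_inf (w * z) p * qpoch_inf (- (w * z)) p = ?R (v * z\<^sup>2)"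
      "qpoch_inf (u * w / z) p * qpoch_inf (- (u * w / z)) p = ?R (p * (u / z\<^sup>2))"
        by (simp_all only: qpoch_inf_minus[OF p])
    qed
    have "kern s (- s) 0 w (- w) z = (qpoch_inf (v * z\<^sup>2) p * qpoch_inf (u / z\<^sup>2) p) /
      ((qpoch_inf (v * s * z) p * qpoch_inf (- (v * s * z)) p) * (qpoch_inf (s / z) p * qpoch_inf (- (s / z)) p) *
       (qpoch_inf (w * z) p * qpoch_inf (- (w * z)) p) * (qpoch_inf (u * w / z) p * qpoch_inf (- (u * w / z)) p))"
      unfolding kern_def p_def by (simp add: mult_ac)
    also have "\<dots> = 1"
    proof -
      have *: "norm (v * z\<^sup>2) < 1" "norm (u / z\<^sup>2) < 1"
        using z norm_u norm_v by (simp_all add: norm_mult norm_divide norm_power)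
      from *[THEN qpoch_inf_nonzero[OF p2]] *[THEN norm_mult_less_one[OF p], THEN qpoch_inf_nonzero[OF p2]]
show ?thesis unfolding num den by (simp add: mult_ac)
    qed
    finally show "kern s (- s) 0 w (- w) z = 1" .
  qed
  then have 1: "circ_mean (kern s (- s) 0 w (- w)) = 1" by (simp add: circ_mean_const)
  have "val s (- s) 0 w (- w) = qpoch_inf p p /
     (qpoch_inf (- p) p * qpoch_inf (- p) p * ((qpoch_inf (s * w) p * qpoch_inf (- (s * w)) p) *
       (qpoch_inf (s * w) p * qpoch_inf (- (s * w)) p)))"
  proof -
    have "s * - s * w * - w = p" "v * s * - s = - p" "u * w * - w = - p"
      unfolding p_def s[symmetric] w[symmetric] by (simp_all add: power2_eq_square mult_ac)
    then show ?thesis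
      unfolding val_def p_def[symmetric] by (simp add: mult_ac)
  qed
  also have "qpoch_inf (s * w) p * qpoch_inf (- (s * w)) p = qpoch_inf p (p\<^sup>2)"
    unfolding qpoch_inf_minus[OF p] using s w by (simp add: power_mult_distrib p_def)
  \<comment> \<open>The square of Euler's identity equating the generating functions of partitions
    into distinct parts and into odd parts.\<close>
  also have "qpoch_inf (- p) p * qpoch_inf (- p) p * (qpoch_inf p (p\<^sup>2) * qpoch_inf p (p\<^sup>2)) = 1"
  proof -
    have "qpoch_inf p p * qpoch_inf (- p) p * qpoch_inf p (p\<^sup>2) = qpoch_inf p p"
      unfolding qpoch_inf_minus[OF p] using qpoch_inf_even_odd[OF p, of p] by (simp add: mult_ac power2_eq_square)
    moreover have "qpoch_inf p p \<noteq> 0" by (rule qpoch_inf_nonzero[OF p p])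
    ultimately have "qpoch_inf (- p) p * qpoch_inf p (p\<^sup>2) = 1" by (simp add: mult.assoc)
    then show ?thesis by (metis mult.assoc mult.commute mult_1_left)
  qed
  finally have "val s (- s) 0 w (- w) = qpoch_inf p p" by simp
  then show "P (u * v) * Q s (- s) 0 w (- w) = 1"
    using qpoch_inf_nonzero[OF p p] 1 by (simp add: Q_def p_def)
qed

theorem circ_mean_kern:
  assumes t: "norm a < 1" "norm b < 1" "norm c < 1" "norm d < 1" "norm e < 1"
  shows "P (u * v) * circ_mean (kern a b c d e) = val a b c d e"
proof -
  \<comment> \<open>Any choice of square roots serves: \<open>Q_const\<close> carries the value
    found at \<open>(s, - s, 0, w, - w)\<close> to the given parameters.\<close>
  obtain s w where sw: "s\<^sup>2 = u" "w\<^sup>2 = v" by (metis power2_csqrt)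
  have "Q a b c d e = Q s (- s) 0 w (- w)"
    using Q_const[OF t] Q_const[of s "- s" 0 w "- w"] Q_base(2,3)[OF sw] by simp
  with Q_base(1)[OF sw] have "P (u * v) * Q a b c d e = 1" by simp
  then show ?thesis using val_nonzero[OF t] by (simp add: Q_def field_simps)
qed

end

section \<open>Specialization to base \<open>q ^ r\<close>\<close>

theorem theorem4:
  fixes r :: nat and t :: "nat \<Rightarrow> complex" and q A :: complex
  assumes r: "r > 1"
    and t: "\<And>a. a \<in> {1..5} \<Longrightarrow> norm (t a) < 1"
    and q: "norm q < 1"
    and A: "A = (\<Prod>a=1..5. t a)"
  shows
    "qpoch_inf (q ^ r) (q ^ r) / (2 * of_real pi * \<i>) *
       contour_integral (circlepath 0 1)
         (\<lambda>z. qpoch_infs [q ^ (r - 1) * A * z, A * inverse z, q ^ (r - 1) * z ^ 2, q * inverse z ^ 2] (q ^ r)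
              / ((\<Prod>a=1..3. qpoch_infs [q ^ (r - 1) * t a * z, t a * inverse z] (q ^ r))
                 * (\<Prod>a=4..5. qpoch_infs [t a * z, q * t a * inverse z] (q ^ r)))
              / z)
     = ((\<Prod>a=1..3. qpoch_inf (prod_except t a) (q ^ r))
          * (\<Prod>a=4..5. qpoch_inf (q ^ (r - 1) * prod_except t a) (q ^ r)))
       / ((\<Prod>(a, b)\<in>{(a, b). 1 \<le> a \<and> a < b \<and> b \<le> 3}. qpoch_inf (q ^ (r - 1) * t a * t b) (q ^ r))
          * (\<Prod>a=1..3. \<Prod>b=4..5. qpoch_inf (t a * t b) (q ^ r))
          * qpoch_inf (q * t 4 * t 5) (q ^ r))"
proof -
  define v where "v = q ^ (r - 1)"
  \<comment> \<open>Here \<open>r > 1\<close> enters: for \<open>r = 1\<close> the second base would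
    be \<open>1\<close>.\<close>
  have "norm v < 1"
    using q r by (simp add: v_def norm_power power_less_one_iff)
  then interpret nassrallah_rahman q v
    using q by unfold_locales
  have p: "q ^ r = q * v"
    using r by (simp add: v_def power_eq_if)
  have sets: "{1..3} = {1, 2, 3 :: nat}" "{4..5} = {4, 5 :: nat}" "{1..5} = {1, 2, 3, 4, 5 :: nat}"
    "{(a, b). 1 \<le> a \<and> a < b \<and> b \<le> (3 :: nat)} = {(1, 2), (1, 3), (2, 3)}"
    by auto
  have A': "A = t 1 * t 2 * t 3 * t 4 * t 5"
    unfolding A sets by (simp add: mult_ac)
  have except: "prod_except t 1 = t 2 * t 3 * t 4 * t 5" "prod_except t 2 = t 1 * t 3 * t 4 * t 5"
    "prod_except t 3 = t 1 * t 2 * t 4 * t 5" "prod_except t 4 = t 1 * t 2 * t 3 * t 5"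
    "prod_except t 5 = t 1 * t 2 * t 3 * t 4"
    unfolding prod_except_def sets by (simp_all add: insert_Diff_if mult_ac)
  let ?F = "\<lambda>z. qpoch_infs [v * A * z, A * inverse z, v * z ^ 2, q * inverse z ^ 2] (q * v)
              / ((\<Prod>a=1..3. qpoch_infs [v * t a * z, t a * inverse z] (q * v))
                 * (\<Prod>a=4..5. qpoch_infs [t a * z, q * t a * inverse z] (q * v)))"
  \<comment> \<open>This holds at \<open>z = 0\<close> too, where \<open>x / z\<close> and
    \<open>x * inverse z\<close> are both \<open>0\<close> by convention; so the two sides agree as
    functions.\<close>
  have "?F z = kern (t 1) (t 2) (t 3) (t 4) (t 5) z" for z
    unfolding kern_def sets qpoch_infs_def A'[symmetric]
    by (simp add: divide_inverse[of _ z] divide_inverse[of _ "z\<^sup>2"] power_inverse mult_ac)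
  then have F: "?F = kern (t 1) (t 2) (t 3) (t 4) (t 5)" ..
  have cancel: "x / c * (c * y) = x * y" if "c \<noteq> 0" for x y c :: complex
    using that by simp
  have "P (q * v) / (2 * of_real pi * \<i>) * contour_integral (circlepath 0 1) (\<lambda>z. ?F z / z) =
      P (q * v) * circ_mean ?F"
    unfolding contour_integral_circlepath_circ_mean by (rule cancel) simp
  also have "\<dots> = val (t 1) (t 2) (t 3) (t 4) (t 5)"
    unfolding F using t by (intro circ_mean_kern) auto
  also have "\<dots> = ((\<Prod>a=1..3. P (prod_except t a)) * (\<Prod>a=4..5. P (v * prod_except t a)))
       / ((\<Prod>(a, b)\<in>{(a, b). 1 \<le> a \<and> a < b \<and> b \<le> 3}. P (v * t a * t b))
          * (\<Prod>a=1..3. \<Prod>b=4..5. P (t a * t b)) * P (q * t 4 * t 5))"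
    unfolding val_def sets by (simp add: except mult_ac del: One_nat_def)
  finally show ?thesis
    unfolding p v_def[symmetric] .
qed

end
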